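(* For every integer $n\ge0$ and real $x\ge0$, $$\sum_{k=0}^{n}\binom{n}{k}(-1)^k\frac{6H_k(x,4)+8H_k(x,3)H_k(x,1)+3(H_k(x,2))^2+6(H_k(x,1))^2H_k(x,2)+(H_k(x,1))^4}{4!\binom{x+k+1}{k}(x+1)}=\frac{1}{(n+x+1)^5},$$ and $$\frac{1}{4!}\sum_{k=0}^{n}\binom{n}{k}(-1)^k\frac{6H_{k+1}^{(4)}+8H_{k+1}^{(3)}H_{k+1}+3(H_{k+1}^{(2)})^2+6(H_{k+1})^2H_{k+1}^{(2)}+(H_{k+1})^4}{k+1}=\frac{1}{(n+1)^5}.$$
   Context: For a positive integer $\alpha$, an integer $n\ge0$ and real $x\ge 0$, $H_n(x,\alpha)=\sum_{k=0}^{n}\frac{1}{(k+x+1)^{\alpha}}$. For positive integers $\alpha$, $H_m^{(\alpha)}=\sum_{j=1}^{m}\frac{1}{j^\alpha}$ ($H_0^{(\alpha)}=0$) and $H_m=H_m^{(1)}$. For real $y$ and integer $k\ge0$, $\binom{y}{k}=\frac{y(y-1)\cdots(y-k+1)}{k!}$. *)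

theory Defs
  imports Complex_Main
begin

definition hurwitz_harm :: "nat \<Rightarrow> real \<Rightarrow> nat \<Rightarrow> real" where
  "hurwitz_harm n x \<alpha> = (\<Sum>k=0..n. 1 / (real k + x + 1) ^ \<alpha>)"

definition gen_harm :: "nat \<Rightarrow> nat \<Rightarrow> real" where
  "gen_harm m \<alpha> = (\<Sum>j=1..m. 1 / real j ^ \<alpha>)"

abbreviation harm_num :: "nat \<Rightarrow> real" where
  "harm_num m \<equiv> gen_harm m 1"

end

theory Submission
  imports Defs
begin

text \<open>
  Put \<open>c = x + 1\<close> and \<open>a j = 1 / (j + c)\<close>. Up to the factor \<open>4!\<close>, the numerator is the Newton
  expression, in power sums, of the complete homogeneous symmetric polynomial \<open>h 4 k\<close> in
  \<open>a 0, \<dots>, a k\<close>. With \<open>w k = 1 / (((c + k) gchoose k) * c)\<close> the functions \<open>F m k = h m k * w k\<close>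
  satisfy \<open>(c + k) * F (m + 1) k - k * F (m + 1) (k - 1) = F m k\<close>, and the alternating binomial
  sum turns the operator on the left into multiplication by \<open>c + n\<close>. Hence every increase of
  \<open>m\<close> divides the sum by \<open>c + n\<close>.
\<close>

text \<open>Moving the subtracted part from index \<open>k\<close> to \<open>k + 1\<close> flips its
  sign, and absorption turns the coefficient \<open>(k + 1) * (n choose (k + 1))\<close> into
  \<open>(n - k) * (n choose k)\<close>. The factors of \<open>f k\<close> then add up to
  \<open>(c + k) + (n - k) = c + n\<close>.\<close>

lemma alternating_binomial_sum_shift:
  fixes f g :: "nat \<Rightarrow> 'a::comm_ring_1"
  assumes g0: "g 0 = c * f 0"
    and gSuc: "\<And>k. g (Suc k) = (c + of_nat (Suc k)) * f (Suc k) - of_nat (Suc k) * f k"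
  shows "(\<Sum>k=0..n. of_nat (n choose k) * (-1) ^ k * g k)
       = (c + of_nat n) * (\<Sum>k=0..n. of_nat (n choose k) * (-1) ^ k * f k)"
proof -
  \<comment> \<open>The factor \<open>of_nat k\<close> makes \<open>t 0\<close> vanish, so the
    truncated \<open>k - 1\<close> does no harm there.\<close>
  define t where "t k = of_nat (n choose k) * of_nat k * (-1) ^ k * f (k - 1)" for k
  have g: "of_nat (n choose k) * (-1) ^ k * g k
         = of_nat (n choose k) * (-1) ^ k * ((c + of_nat k) * f k) - t k" for k
    by (cases k) (simp_all add: g0 gSuc t_def algebra_simps del: of_nat_Suc)
  have t_Suc: "t (Suc k) = - (of_nat (n choose k) * (-1) ^ k * ((of_nat n - of_nat k) * f k))"
    if "k \<le> n" for k
  proof -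
    have "(n choose Suc k) * Suc k = (n choose k) * (n - k)"
      using binomial_absorb_comp[of n k] binomial_absorption[of k n]
      by (simp add: mult.commute)
    then have "of_nat (n choose Suc k) * of_nat (Suc k)
             = (of_nat (n choose k) * (of_nat n - of_nat k) :: 'a)"
      using that by (metis of_nat_mult of_nat_diff)
    then show ?thesis
      by (simp add: t_def del: of_nat_Suc)
  qed
  \<comment> \<open>Both boundary terms are zero: \<open>t (Suc n)\<close> because
    \<open>n choose Suc n = 0\<close>, and \<open>t 0\<close>. Hence the sum can be reindexed
    without remainder.\<close>
  have "(\<Sum>k=0..n. t k) = (\<Sum>k=0..Suc n. t k)"
    by (simp add: t_def binomial_eq_0)
  also have "\<dots> = (\<Sum>k=0..n. t (Suc k))"
    by (subst sum.atLeast0_atMost_Suc_shift) (simp add: t_def)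
  also have "\<dots> = - (\<Sum>k=0..n. of_nat (n choose k) * (-1) ^ k * ((of_nat n - of_nat k) * f k))"
    by (simp add: t_Suc sum_negf)
  finally show ?thesis
    unfolding g sum_subtractf
    by (simp add: sum.distrib[symmetric] sum_distrib_left) (simp add: algebra_simps)
qed

text \<open>The recursion sorts the monomials of degree \<open>Suc m\<close> in
  \<open>a 0, ..., a k\<close> by their largest index \<open>j\<close>.\<close>

fun complete_hom :: "(nat \<Rightarrow> 'a::comm_semiring_1) \<Rightarrow> nat \<Rightarrow> nat \<Rightarrow> 'a" where
  "complete_hom a 0 k = 1"
| "complete_hom a (Suc m) k = (\<Sum>j=0..k. a j * complete_hom a m j)"

text \<open>Passing from \<open>k\<close> to \<open>Suc k\<close> adds \<open>a (Suc k)\<close>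
  times the polynomial of one degree less at \<open>Suc k\<close>, so each identity follows by
  induction on \<open>k\<close> from the one before it. Multiplying by the factorial of the degree
  avoids division in the ring.\<close>

lemma complete_hom_newton:
  fixes a :: "nat \<Rightarrow> 'a::comm_ring_1"
  defines "p r k \<equiv> \<Sum>j=0..k. a j ^ r"
  shows "complete_hom a 1 k = p 1 k"
    and "2 * complete_hom a 2 k = p 2 k + p 1 k ^ 2"
    and "6 * complete_hom a 3 k = 2 * p 3 k + 3 * p 1 k * p 2 k + p 1 k ^ 3"
    and "24 * complete_hom a 4 k
       = 6 * p 4 k + 8 * p 3 k * p 1 k + 3 * (p 2 k)\<^sup>2 + 6 * (p 1 k)\<^sup>2 * p 2 k + p 1 k ^ 4"
proof -
  have p0: "p r 0 = a 0 ^ r" and pS: "p r (Suc k) = p r k + a (Suc k) ^ r" for r k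
    by (simp_all add: p_def)
  have h0: "complete_hom a (Suc m) 0 = a 0 * complete_hom a m 0"
    and hS: "complete_hom a (Suc m) (Suc k)
           = complete_hom a (Suc m) k + a (Suc k) * complete_hom a m (Suc k)" for m k
    by simp_all
  show h1: "complete_hom a 1 k = p 1 k" for k
    by (simp add: p_def)
  show h2: "2 * complete_hom a 2 k = p 2 k + p 1 k ^ 2" for k
  proof (induction k)
    case 0
    show ?case
      using h0[of 1] by (simp add: numeral_2_eq_2 p0)
  next
    case (Suc k)
    have "2 * complete_hom a 2 (Suc k)
        = 2 * complete_hom a 2 k + 2 * a (Suc k) * complete_hom a 1 (Suc k)"
      using hS[of 1 k] by (simp add: eval_nat_numeral algebra_simps)
    then show ?case
      unfolding Suc h1 pS by (simp add: eval_nat_numeral algebra_simps)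
  qed
  show h3: "6 * complete_hom a 3 k = 2 * p 3 k + 3 * p 1 k * p 2 k + p 1 k ^ 3" for k
  proof (induction k)
    case 0
    show ?case
      by (simp add: numeral_eq_Suc p0 algebra_simps)
  next
    case (Suc k)
    have "6 * complete_hom a 3 (Suc k)
        = 6 * complete_hom a 3 k + 3 * a (Suc k) * (2 * complete_hom a 2 (Suc k))"
      using hS[of 2 k] by (simp add: eval_nat_numeral algebra_simps)
    then show ?case
      unfolding Suc h2 pS by (simp add: eval_nat_numeral algebra_simps)
  qed
  show "24 * complete_hom a 4 k
       = 6 * p 4 k + 8 * p 3 k * p 1 k + 3 * (p 2 k)\<^sup>2 + 6 * (p 1 k)\<^sup>2 * p 2 k + p 1 k ^ 4"
  proof (induction k)
    case 0
    show ?case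
      by (simp add: numeral_eq_Suc p0 algebra_simps)
  next
    case (Suc k)
    \<comment> \<open>Splitting 24 as \<open>4 * 6\<close> exposes the left side of
      \<open>h3\<close>, which can then be rewritten at \<open>Suc k\<close>.\<close>
    have "24 * complete_hom a 4 (Suc k)
        = 24 * complete_hom a 4 k + 4 * a (Suc k) * (6 * complete_hom a 3 (Suc k))"
      using hS[of 3 k] by (simp add: eval_nat_numeral algebra_simps)
    then show ?case
      unfolding Suc h3 pS by (simp add: eval_nat_numeral algebra_simps)
  qed
qed

lemma alternating_binomial_sum_complete_hom:
  fixes c :: real
  assumes "c > 0"
  shows "(\<Sum>k=0..n. real (n choose k) * (-1) ^ k *
            (complete_hom (\<lambda>j. 1 / (real j + c)) m k / (((c + real k) gchoose k) * c)))
       = 1 / (real n + c) ^ Suc m"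
proof -
  define h where "h = complete_hom (\<lambda>j. 1 / (real j + c))"
  define w where "w k = 1 / (((c + real k) gchoose k) * c)" for k
  have w0: "w 0 = 1 / c"
    by (simp add: w_def)
  have wS: "(c + real (Suc k)) * w (Suc k) = real (Suc k) * w k" for k
  proof -
    have "real (Suc k) * ((c + real (Suc k)) gchoose Suc k)
        = (c + real (Suc k)) * ((c + real k) gchoose k)"
      using Suc_times_gbinomial[of k "c + real k"] by (simp add: algebra_simps)
    then have "((c + real (Suc k)) gchoose Suc k)
        = (c + real (Suc k)) * ((c + real k) gchoose k) / real (Suc k)"
      by (simp add: field_simps del: of_nat_Suc)
    moreover have "c + real (Suc k) \<noteq> 0"
      using assms by linarith
    ultimately show ?thesis
      by (simp add: w_def del: of_nat_Suc)
  qed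
  have "(\<Sum>k=0..n. real (n choose k) * (-1) ^ k * (h m k * w k)) = 1 / (real n + c) ^ Suc m"
  proof (induction m)
    case 0
    \<comment> \<open>In degree 0 the operator sends \<open>w\<close> to the indicator of
      \<open>k = 0\<close>: \<open>wS\<close> cancels all later values, and
      \<open>c * w 0 = 1\<close>.\<close>
    have "(\<Sum>k=0..n. real (n choose k) * (-1) ^ k * (if k = 0 then 1 else 0))
        = (c + real n) * (\<Sum>k=0..n. real (n choose k) * (-1) ^ k * (h 0 k * w k))"
      by (rule alternating_binomial_sum_shift) (use assms wS in \<open>simp_all add: h_def w0\<close>)
    moreover have "(\<Sum>k=0..n. real (n choose k) * (-1) ^ k * (if k = 0 then 1 else 0)) = 1"
      by (simp add: if_distrib[of "\<lambda>y. _ * y"] sum.delta cong: if_cong)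
    ultimately show ?case
      using assms by (simp add: field_simps)
  next
    case (Suc m)
    have "(\<Sum>k=0..n. real (n choose k) * (-1) ^ k * (h m k * w k))
        = (c + real n) * (\<Sum>k=0..n. real (n choose k) * (-1) ^ k * (h (Suc m) k * w k))"
    proof (rule alternating_binomial_sum_shift)
      show "h m 0 * w 0 = c * (h (Suc m) 0 * w 0)"
        using assms by (simp add: h_def)
    next
      fix k
      have "h (Suc m) (Suc k) = h (Suc m) k + h m (Suc k) / (c + real (Suc k))"
        by (simp add: h_def add_ac)
      moreover have "c + real (Suc k) \<noteq> 0"
        using assms by linarith
      ultimately have "(c + real (Suc k)) * h (Suc m) (Suc k)
          = (c + real (Suc k)) * h (Suc m) k + h m (Suc k)"
        by (simp add: field_simps del: of_nat_Suc)
      \<comment> \<open>By \<open>wS\<close> both products on the right carry the factor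
        \<open>(c + real (Suc k)) * w (Suc k)\<close>, so only the increment of
        \<open>h (Suc m)\<close> survives.\<close>
      with wS[of k] show "h m (Suc k) * w (Suc k)
          = (c + real (Suc k)) * (h (Suc m) (Suc k) * w (Suc k))
            - real (Suc k) * (h (Suc m) k * w k)"
        by algebra
    qed
    then have "(\<Sum>k=0..n. real (n choose k) * (-1) ^ k * (h (Suc m) k * w k))
        = 1 / (real n + c) ^ Suc m / (real n + c)"
      unfolding Suc using assms by (simp add: eq_divide_eq add_ac mult_ac)
    then show ?case
      by (simp add: mult_ac)
  qed
  then show ?thesis
    by (simp add: h_def w_def)
qed

lemma hurwitz_harm_0: "hurwitz_harm k 0 r = gen_harm (k + 1) r"
  unfolding hurwitz_harm_def gen_harm_def
  using sum.shift_bounds_cl_Suc_ivl[of "\<lambda>j. 1 / real j ^ r" 0 k] by (simp add: add_ac)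

lemma alternating_binomial_sum_hurwitz_harm:
  fixes x :: real
  assumes "x \<ge> 0"
  shows "(\<Sum>k=0..n. real (n choose k) * (-1) ^ k *
            ((6 * hurwitz_harm k x 4 + 8 * hurwitz_harm k x 3 * hurwitz_harm k x 1
              + 3 * (hurwitz_harm k x 2)\<^sup>2 + 6 * (hurwitz_harm k x 1)\<^sup>2 * hurwitz_harm k x 2
              + (hurwitz_harm k x 1) ^ 4)
             / (fact 4 * ((x + real k + 1) gchoose k) * (x + 1))))
         = 1 / (real n + x + 1) ^ 5"
proof -
  define h where "h = complete_hom (\<lambda>j. 1 / (real j + (x + 1)))"
  have p: "(\<Sum>j=0..k. (1 / (real j + (x + 1))) ^ r) = hurwitz_harm k x r" for k r
    by (simp add: hurwitz_harm_def power_one_over add_ac)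
  have "6 * hurwitz_harm k x 4 + 8 * hurwitz_harm k x 3 * hurwitz_harm k x 1
              + 3 * (hurwitz_harm k x 2)\<^sup>2 + 6 * (hurwitz_harm k x 1)\<^sup>2 * hurwitz_harm k x 2
              + (hurwitz_harm k x 1) ^ 4 = 24 * h 4 k" for k
    using complete_hom_newton(4)[of "\<lambda>j. 1 / (real j + (x + 1))" k] unfolding h_def p by simp
  moreover have "24 * h 4 k / (fact 4 * ((x + real k + 1) gchoose k) * (x + 1))
      = h 4 k / (((x + 1 + real k) gchoose k) * (x + 1))" for k
    by (simp add: fact_numeral add_ac)
  ultimately show ?thesis
    using alternating_binomial_sum_complete_hom[of "x + 1" n 4] assms
    by (simp add: h_def add_ac)
qed

theorem theorem2p5:
  fixes n :: nat and x :: real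
  assumes "x \<ge> 0"
  shows "(\<Sum>k=0..n. real (n choose k) * (-1) ^ k *
            ((6 * hurwitz_harm k x 4 + 8 * hurwitz_harm k x 3 * hurwitz_harm k x 1
              + 3 * (hurwitz_harm k x 2)\<^sup>2 + 6 * (hurwitz_harm k x 1)\<^sup>2 * hurwitz_harm k x 2
              + (hurwitz_harm k x 1) ^ 4)
             / (fact 4 * ((x + real k + 1) gchoose k) * (x + 1))))
         = 1 / (real n + x + 1) ^ 5
       \<and> 1 / fact 4 * (\<Sum>k=0..n. real (n choose k) * (-1) ^ k *
            ((6 * gen_harm (k + 1) 4 + 8 * gen_harm (k + 1) 3 * harm_num (k + 1)
              + 3 * (gen_harm (k + 1) 2)\<^sup>2 + 6 * (harm_num (k + 1))\<^sup>2 * gen_harm (k + 1) 2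
              + (harm_num (k + 1)) ^ 4)
             / real (k + 1)))
         = 1 / (real n + 1) ^ 5"
proof (rule conjI)
  \<comment> \<open>At \<open>x = 0\<close> this turns the binomial in the denominator of the first
    identity into the \<open>k + 1\<close> of the second.\<close>
  have "((real k + 1) gchoose k) = real (k + 1)" for k
    using binomial_gbinomial[of "Suc k" k, where 'a = real] by (simp add: add_ac)
  then show "1 / fact 4 * (\<Sum>k=0..n. real (n choose k) * (-1) ^ k *
            ((6 * gen_harm (k + 1) 4 + 8 * gen_harm (k + 1) 3 * harm_num (k + 1)
              + 3 * (gen_harm (k + 1) 2)\<^sup>2 + 6 * (harm_num (k + 1))\<^sup>2 * gen_harm (k + 1) 2
              + (harm_num (k + 1)) ^ 4)
             / real (k + 1)))
         = 1 / (real n + 1) ^ 5"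
    using alternating_binomial_sum_hurwitz_harm[of 0 n]
    unfolding sum_distrib_left hurwitz_harm_0 by (simp add: field_simps)
qed (rule alternating_binomial_sum_hurwitz_harm[OF assms])

end
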